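(* Let $p\in(0,1)$ and let $N$ be a random variable with values in $\{1,2,\ldots\}$, probability function $f_N$, and $E(N)<\infty$. Put $\boldsymbol{\pi}=(f_N(1),f_N(2),\ldots)$. Consider the Gerber-Dickson risk model whose claims $Y_1,Y_2,\ldots$ are i.i.d. with $\mathrm{NBM}(\boldsymbol{\pi},p)$ distribution, and assume the net profit condition $\mu=E(Y_1)=E(N)(1-p)/p<1$. For $u\ge1$ let $Z_u\sim\mathrm{NegBin}(u,1-p)$. Then the ultimate ruin probability satisfies $$\psi(u)=\sum_{k=0}^{\infty}\overline{C}_k\cdot P(Z_u=k)=E\left(\overline{C}_{Z_u}\right),\qquad u\ge1,$$ where the sequence $\{\overline{C}_k\}_{k=0}^\infty$ is given recursively by $$\overline{C}_0=E(N)(1-p)/p,$$ $$\overline{C}_k=\overline{C}_0\left[\sum_{i=1}^{k}f_{Ne}(i)\,\overline{C}_{k-i}+\overline{F}_{Ne}(k)\right],\quad k\ge1,$$ $$f_{Ne}(i)=\frac{\overline{F}_N(i-1)}{E(N)},\quad i\ge1.$$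
   Context: Gerber-Dickson model: for an integer $u\ge0$ and i.i.d. random variables $Y_1,Y_2,\ldots$ (the claims) with values in $\{0,1,2,\ldots\}$, the risk process is $U(t)=u+t-\sum_{i=1}^{t}Y_i$, $t=0,1,2,\ldots$. The ruin time is $\tau=\min\{t\ge1: U(t)\le0\}$ ($\tau=\infty$ if the set is empty), and the ultimate ruin probability is $\psi(u)=P(\tau<\infty\mid U(0)=u)$. Notation: $\mathrm{NegBin}(k,p)$ is the negative binomial distribution with probability function $\mathrm{nb}(k,p)(x)=\binom{k+x-1}{x}p^k(1-p)^x$, $x=0,1,2,\ldots$. For $\boldsymbol{\pi}=(q_1,q_2,\ldots)$ with $q_k\ge0$ and $\sum_{k\ge1}q_k=1$, $\mathrm{NBM}(\boldsymbol{\pi},p)$ is the distribution on $\{0,1,2,\ldots\}$ with probability function $f(x)=\sum_{k=1}^\infty q_k\,\mathrm{nb}(k,p)(x)$. Tails: $\overline{F}_N(j)=P(N>j)=\sum_{k>j}f_N(k)$ and $\overline{F}_{Ne}(k)=\sum_{i>k}f_{Ne}(i)$. *)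

theory Defs
  imports "HOL-Probability.Probability" "HOL-Library.Extended_Nat"
begin

text \<open>
  The claims are \<open>Y 1, Y 2, \<dots>\<close>; the value \<open>Y 0\<close> is never used.  The process is integer
  valued, since it becomes negative when a claim exceeds the available capital.
\<close>

definition risk_process :: "(nat \<Rightarrow> 'a \<Rightarrow> nat) \<Rightarrow> nat \<Rightarrow> nat \<Rightarrow> 'a \<Rightarrow> int" where
  "risk_process Y u t \<omega> = int u + int t - (\<Sum>i=1..t. int (Y i \<omega>))"

text \<open>In \<^typ>\<open>enat\<close> the infimum of the empty set is \<open>\<infinity>\<close>; a nonempty set attains its infimum.\<close>

definition ruin_time :: "(nat \<Rightarrow> 'a \<Rightarrow> nat) \<Rightarrow> nat \<Rightarrow> 'a \<Rightarrow> enat" where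
  "ruin_time Y u \<omega> = (INF t\<in>{t. 1 \<le> t \<and> risk_process Y u t \<omega> \<le> 0}. enat t)"

definition ruin_prob :: "'a measure \<Rightarrow> (nat \<Rightarrow> 'a \<Rightarrow> nat) \<Rightarrow> nat \<Rightarrow> real" where
  "ruin_prob M Y u = measure M {\<omega> \<in> space M. ruin_time Y u \<omega> < \<infinity>}"

text \<open>
  The weights are \<open>q 1, q 2, \<dots>\<close>, so the series runs over \<open>Suc k\<close>.  The library distribution
  \<^const>\<open>neg_binomial_pmf\<close> counts the failures before the \<open>k\<close>-th success; its probability
  function \<open>(k + x - 1 choose x) * p ^ k * (1 - p) ^ x\<close> is lemma \<open>pmf_neg_binomial\<close>.
\<close>

definition nbm :: "(nat \<Rightarrow> real) \<Rightarrow> real \<Rightarrow> nat \<Rightarrow> real" where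
  "nbm q p x = (\<Sum>k. q (Suc k) * pmf (neg_binomial_pmf (Suc k) p) x)"

text \<open>The tail \<open>\<Sum>\<^bsub>i>j\<^esub> f i\<close> of a probability function on the natural numbers.\<close>

definition tail :: "(nat \<Rightarrow> real) \<Rightarrow> nat \<Rightarrow> real" where
  "tail f j = (\<Sum>i. f (Suc j + i))"

end

theory Submission
  imports Defs
begin

text \<open>
  Take independent trials, each a success with probability \<open>p\<close>.  Given \<open>N\<close>, a claim is the number of
  failures before the \<open>N\<close>-th success, and \<open>Z\<^sub>v\<close> is the number of successes before the \<open>v\<close>-th failure.
  Suppose that the claim is \<open>y \<le> u\<close>.  The capital is then \<open>u + 1 - y\<close>, and the number of successes before
  the \<open>(u + 1)\<close>-st failure is \<open>N\<close> plus an independent copy of \<open>Z\<^bsub>u+1-y\<^esub>\<close>; the claim exceeds \<open>u\<close> exactly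
  when that number is smaller than \<open>N\<close>.  Extend \<open>C\<close> by \<open>1\<close> to negative arguments and put
  \<open>w v = E (C Z\<^sub>v)\<close> for \<open>v \<ge> 1\<close> and \<open>w v = 1\<close> for \<open>v \<le> 0\<close>.  The expected value of \<open>w\<close> after one claim
  is therefore \<open>E (C (Z\<^bsub>u+1\<^esub> - N))\<close> (\<open>neg_binomial_duality\<close>).

  The recursion for \<open>C\<close> is a defective renewal equation:  \<open>C k\<close> is the tail at \<open>k\<close> of a geometric
  sum of variables with the equilibrium distribution of \<open>N\<close>, so it decreases to \<open>0\<close>, because \<open>C 0 < 1\<close> by the net profit condition.
  Since consecutive equilibrium weights differ by a multiple of \<open>P (N = i)\<close>, subtracting consecutive
  instances of the recursion gives \<open>(1 - p) E (C (k - N)) = C k - p C (k + 1)\<close>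
  (\<open>defective_renewal_difference\<close>).  Taking \<open>k = Z\<^bsub>u+1\<^esub>\<close> and conditioning on the first trial turns the
  right-hand side into \<open>(1 - p) w u\<close>.  Hence \<open>w u = E (w (u + 1 - Y))\<close> (\<open>mixed_ruin_harmonic\<close>): the
  function \<open>w\<close> satisfies the same one-step equation as the ruin probability, with the same value \<open>1\<close>
  at ruin.

  It remains to see that this equation has only one solution that tends to \<open>0\<close>.  The probability of ruin
  within \<open>t\<close> steps is computed by iterating the equation from the indicator of ruin, so it stays below \<open>w\<close>
  and increases to the ruin probability.  The difference between \<open>w\<close> and this limit is nonnegative, tends
  to \<open>0\<close>, vanishes at ruin and equals its own mean after one claim.  If it were positive somewhere, it would
  attain a positive maximum; every value reached after one claim would then equal this maximum, but a claim
  can be large enough to cause ruin, where the difference is \<open>0\<close>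
  (\<open>finite_horizon_ruin_tendsto\<close>).

  Capital, and the argument of \<open>C\<close>, are natural numbers below, and truncated subtraction encodes the values
  beyond the boundary:  all capitals \<open>\<le> 0\<close> become \<open>0\<close>, and \<open>C\<close> is shifted to \<open>c 0 = 1\<close>,
  \<open>c (k + 1) = C k\<close>.
\<close>

section \<open>Expectations under discrete distributions\<close>

lemma integrable_pmf_bounded:
  fixes h :: "'a \<Rightarrow> real"
  assumes "\<And>x. \<bar>h x\<bar> \<le> B"
  shows "integrable (measure_pmf Q) h"
  by (rule measure_pmf.integrable_const_bound[where B = B]) (use assms in auto)

lemma expectation_pmf_sums:
  fixes h :: "nat \<Rightarrow> real"
  assumes "\<And>x. \<bar>h x\<bar> \<le> B"
  shows "(\<lambda>n. pmf Q n * h n) sums measure_pmf.expectation Q h"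
proof -
  have "integrable (count_space UNIV) (\<lambda>n. pmf Q n *\<^sub>R h n)"
    using integrable_pmf_bounded[OF assms, where Q=Q] unfolding measure_pmf_eq_density
    by (subst (asm) integrable_density) auto
  then have "(\<lambda>n. pmf Q n * h n) sums (\<integral>n. pmf Q n * h n \<partial>count_space UNIV)"
    using sums_integral_count_space_nat[of "\<lambda>n. pmf Q n * h n"] by simp
  moreover have "measure_pmf.expectation Q h = (\<integral>n. pmf Q n * h n \<partial>count_space UNIV)"
    unfolding measure_pmf_eq_density by (subst integral_density) auto
  ultimately show ?thesis by simp
qed

lemma expectation_bind_pmf:
  fixes h :: "'b \<Rightarrow> real"
  assumes "\<And>x. \<bar>h x\<bar> \<le> B"
  shows "measure_pmf.expectation (bind_pmf Q K) h
       = measure_pmf.expectation Q (\<lambda>x. measure_pmf.expectation (K x) h)"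
  unfolding measure_pmf_bind
  by (rule integral_bind[where K = "count_space UNIV" and B = B and B' = 1])
     (use assms measurable_measure_pmf[of K] in
       \<open>auto simp: measure_pmf.emeasure_space_1[simplified] measure_pmf.finite_measure_axioms\<close>)

lemma expectation_pmf_swap:
  fixes h :: "'a \<Rightarrow> 'b \<Rightarrow> real"
  assumes h: "\<And>x y. \<bar>h x y\<bar> \<le> B"
  shows "measure_pmf.expectation Q (\<lambda>x. measure_pmf.expectation R (h x))
       = measure_pmf.expectation R (\<lambda>y. measure_pmf.expectation Q (\<lambda>x. h x y))"
proof -
  have "measure_pmf.expectation (bind_pmf Q (\<lambda>x. bind_pmf R (\<lambda>y. return_pmf (x, y)))) (case_prod h)
      = measure_pmf.expectation (bind_pmf R (\<lambda>y. bind_pmf Q (\<lambda>x. return_pmf (x, y)))) (case_prod h)"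
    by (subst bind_commute_pmf) (rule refl)
  moreover have "\<bar>case_prod h z\<bar> \<le> B" for z
    using h by (cases z) simp
  ultimately show ?thesis
    by (simp add: expectation_bind_pmf[where B = B])
qed

lemma expectation_pmf_mono:
  fixes h g :: "'a \<Rightarrow> real"
  assumes "\<And>x. \<bar>h x\<bar> \<le> B" "\<And>x. \<bar>g x\<bar> \<le> B'" "\<And>x. h x \<le> g x"
  shows "measure_pmf.expectation Q h \<le> measure_pmf.expectation Q g"
  by (rule integral_mono) (use assms integrable_pmf_bounded in blast)+

lemma expectation_pmf_unit_interval:
  fixes h :: "'a \<Rightarrow> real"
  assumes "\<And>x. 0 \<le> h x" "\<And>x. h x \<le> 1"
  shows "0 \<le> measure_pmf.expectation Q h" "measure_pmf.expectation Q h \<le> 1"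
proof -
  show "0 \<le> measure_pmf.expectation Q h" using assms by simp
  show "measure_pmf.expectation Q h \<le> 1"
    by (rule measure_pmf.integral_le_const[OF integrable_pmf_bounded[where B = 1]])
       (use assms in \<open>auto simp: abs_le_iff intro: order_trans[of "- _" 0]\<close>)
qed

lemma nat_random_variable_has_pmf:
  fixes X :: "'a \<Rightarrow> nat"
  assumes "prob_space P" and X: "X \<in> measurable P (count_space UNIV)"
  obtains Q where "distr P (count_space UNIV) X = measure_pmf Q"
proof -
  interpret P: prob_space P by fact
  interpret D: prob_space "distr P (count_space UNIV) X" by (rule P.prob_space_distr[OF X])
  have "\<exists>S::nat set. countable S \<and> (AE x in distr P (count_space UNIV) X. x \<in> S)"
    by (rule exI[of _ UNIV]) auto
  then have "AE x in distr P (count_space UNIV) X. measure (distr P (count_space UNIV) X) {x} \<noteq> 0"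
    by (subst D.AE_support_countable) auto
  then have "distr P (count_space UNIV) X = measure_pmf (Abs_pmf (distr P (count_space UNIV) X))"
    by (subst Abs_pmf_inverse) (auto simp: D.prob_space_axioms)
  then show ?thesis using that by blast
qed

lemma distr_eq_pmf_transfer:
  fixes X :: "'a \<Rightarrow> 'b" and g :: "'b \<Rightarrow> real"
  assumes X: "X \<in> measurable M (count_space UNIV)"
    and distr: "distr M (count_space UNIV) X = measure_pmf Q"
  shows "measure M {\<omega> \<in> space M. X \<omega> = k} = pmf Q k"
    and "integrable M (\<lambda>\<omega>. g (X \<omega>)) \<longleftrightarrow> integrable (measure_pmf Q) g"
    and "(\<integral>\<omega>. g (X \<omega>) \<partial>M) = measure_pmf.expectation Q g"
proof -
  show "measure M {\<omega> \<in> space M. X \<omega> = k} = pmf Q k"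
    using measure_distr[OF X, of "{k}"] unfolding distr
    by (simp add: vimage_def Int_def conj_commute measure_pmf_single)
  show "integrable M (\<lambda>\<omega>. g (X \<omega>)) \<longleftrightarrow> integrable (measure_pmf Q) g"
    using integrable_distr_eq[OF X, of g] unfolding distr by simp
  show "(\<integral>\<omega>. g (X \<omega>) \<partial>M) = measure_pmf.expectation Q g"
    using integral_distr[OF X, of g] unfolding distr by simp
qed

lemma distributed_pmf_distr:
  assumes "distributed M (count_space UNIV) X (\<lambda>x. ennreal (pmf Q x))"
  shows "distr M (count_space UNIV) X = measure_pmf Q"
  using distributed_distr_eq_density[OF assms] by (simp add: measure_pmf_eq_density)

section \<open>Tails of distributions on the natural numbers\<close>

lemma summable_pmf_nat: "summable (pmf (Q :: nat pmf))"
  using expectation_pmf_sums[of "\<lambda>_. 1" 1 Q] by (simp add: sums_iff)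

lemma tail_pmf_eq_measure: "tail (pmf Q) j = measure_pmf.prob Q {j<..}"
proof -
  have "(\<lambda>n. pmf Q n * indicator {j<..} n) sums measure_pmf.expectation Q (indicator {j<..})"
    by (rule expectation_pmf_sums[of _ 1]) (simp add: indicator_def)
  then have "(\<lambda>n. pmf Q (n + Suc j) * indicator {j<..} (n + Suc j)) sums measure_pmf.prob Q {j<..}"
    by (subst sums_iff_shift) simp
  then show ?thesis
    by (simp add: tail_def sums_iff indicator_def add.commute)
qed

lemma tail_pmf_nonneg: "0 \<le> tail (pmf Q) j"
  by (simp add: tail_pmf_eq_measure)

lemma tail_pmf_Suc: "tail (pmf Q) j = pmf Q (Suc j) + tail (pmf Q) (Suc j)"
proof -
  have "summable (\<lambda>i. pmf Q (Suc j + i))"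
    using summable_ignore_initial_segment[OF summable_pmf_nat, of Q "Suc j"] by (simp add: add.commute)
  from suminf_split_head[OF this] show ?thesis
    by (simp add: tail_def)
qed

lemma tail_pmf_0:
  assumes "pmf Q 0 = 0"
  shows "tail (pmf Q) 0 = 1"
  using suminf_split_head[OF summable_pmf_nat, of Q] sums_unique[OF expectation_pmf_sums[of "\<lambda>_. 1" 1 Q]] assms
  by (simp add: tail_def)

text \<open>
  The mean as a sum of tails is what gives the equilibrium weights \<open>P (N > i) / E N\<close> total mass \<open>1\<close>.
\<close>

lemma tail_pmf_sums_expectation:
  assumes "integrable (measure_pmf Q) real"
  shows "tail (pmf Q) sums measure_pmf.expectation Q real"
proof -
  have "ennreal (tail (pmf Q) t) = emeasure (measure_pmf Q) {x \<in> space (measure_pmf Q). t < x}" for t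
    unfolding tail_pmf_eq_measure measure_pmf.emeasure_eq_measure[symmetric]
    by (rule arg_cong) auto
  then have "(\<Sum>t. ennreal (tail (pmf Q) t)) = (\<integral>\<^sup>+x. of_nat x \<partial>measure_pmf Q)"
    by (subst nn_integral_nat_function) auto
  also have "\<dots> = ennreal (measure_pmf.expectation Q real)"
    unfolding ennreal_of_nat_eq_real_of_nat using assms
    by (subst nn_integral_eq_integral) auto
  finally have "(\<lambda>t. ennreal (tail (pmf Q) t)) sums ennreal (measure_pmf.expectation Q real)"
    using summable_sums[OF summableI[of "\<lambda>t. ennreal (tail (pmf Q) t)"]] by simp
  then show ?thesis
    using sums_ennreal[of "tail (pmf Q)" "measure_pmf.expectation Q real"]
    by (simp add: tail_pmf_nonneg)
qed

section \<open>Negative binomial distributions and their mixtures\<close>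

text \<open>
  Condition on the first trial: a success leaves \<open>n\<close> successes to wait for, a failure is counted and the
  waiting starts afresh.
\<close>

lemma expectation_neg_binomial_Suc:
  fixes h :: "nat \<Rightarrow> real"
  assumes p: "0 < p" "p < 1" and h: "\<And>x. \<bar>h x\<bar> \<le> B"
  shows "measure_pmf.expectation (neg_binomial_pmf (Suc n) p) h
       = p * measure_pmf.expectation (neg_binomial_pmf n p) h
       + (1 - p) * measure_pmf.expectation (neg_binomial_pmf (Suc n) p) (\<lambda>y. h (Suc y))"
  using p by (subst neg_binomial_pmf_unfold) (auto simp: expectation_bind_pmf[OF h])

text \<open>
  Waiting for more and more events makes the count exceed every bound.  The proof avoids estimates of
  binomial coefficients:  for each \<open>j\<close>, the expectation of \<open>h (k + j)\<close> decreases in \<open>v\<close> to a limit \<open>l j\<close>,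
  and conditioning on the first trial gives \<open>l j = q l j + (1 - q) l (j + 1)\<close>.  So \<open>l\<close> is constant, and it
  lies below the null sequence \<open>h\<close>.
\<close>

lemma expectation_neg_binomial_tendsto_0:
  fixes h :: "nat \<Rightarrow> real"
  assumes q: "0 < q" "q < 1" and h: "decseq h" "h \<longlonglongrightarrow> 0"
  shows "(\<lambda>v. measure_pmf.expectation (neg_binomial_pmf v q) h) \<longlonglongrightarrow> 0"
proof -
  define e where "e j v = measure_pmf.expectation (neg_binomial_pmf v q) (\<lambda>k. h (k + j))" for j v
  have h0: "0 \<le> h k" for k using h by (rule decseq_ge)
  have hB: "\<bar>h (k + j)\<bar> \<le> h 0" for k j using h0 decseqD[OF h(1), of 0 "k + j"] by simp
  have step: "e j (Suc v) = q * e j v + (1 - q) * e (Suc j) (Suc v)" for j v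
    unfolding e_def by (subst expectation_neg_binomial_Suc[OF q hB]) simp
  have e0: "0 \<le> e j v" for j v unfolding e_def using h0 by simp
  have le: "e j v \<le> h j" for j v unfolding e_def
    by (intro measure_pmf.integral_le_const integrable_pmf_bounded[OF hB])
       (use decseqD[OF h(1)] in auto)
  have dec: "e (Suc j) v \<le> e j v" for j v unfolding e_def
    by (intro expectation_pmf_mono[OF hB hB]) (use decseqD[OF h(1)] in auto)
  have "e j (Suc v) \<le> e j v" for j v
  proof -
    have "(1 - q) * e (Suc j) (Suc v) \<le> (1 - q) * e j (Suc v)"
      using q dec by (intro mult_left_mono) auto
    then have "q * e j (Suc v) \<le> q * e j v"
      using step[of j v] left_diff_distrib[of 1 q "e j (Suc v)"] by linarith
    with q show ?thesis by simp
  qed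
  then have "decseq (e j)" for j by (intro decseq_SucI)
  then have "\<exists>l. e j \<longlonglongrightarrow> l" for j
    using e0 by (metis decseq_convergent)
  then obtain l where l: "\<And>j. e j \<longlonglongrightarrow> l j" by metis
  have "l j = l (Suc j)" for j
  proof -
    have "(\<lambda>v. q * e j v + (1 - q) * e (Suc j) (Suc v)) \<longlonglongrightarrow> q * l j + (1 - q) * l (Suc j)"
      by (intro tendsto_intros l LIMSEQ_Suc)
    then have "(\<lambda>v. e j (Suc v)) \<longlonglongrightarrow> q * l j + (1 - q) * l (Suc j)"
      by (simp only: step[symmetric])
    then have "l j = q * l j + (1 - q) * l (Suc j)"
      using LIMSEQ_Suc[OF l[of j]] by (rule LIMSEQ_unique[rotated])
    then have "(1 - q) * l j = (1 - q) * l (Suc j)" by (simp add: algebra_simps)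
    with q show ?thesis by simp
  qed
  then have const: "l j = l 0" for j by (induction j) auto
  have "l 0 \<le> h j" for j
    using LIMSEQ_le_const2[OF l[of j]] le const by metis
  then have "l 0 \<le> 0" using LIMSEQ_le_const[OF h(2)] by blast
  moreover have "0 \<le> l 0" using LIMSEQ_le_const[OF l[of 0]] e0 by blast
  ultimately show ?thesis using l[of 0] by (simp add: e_def[abs_def])
qed

lemma pmf_neg_binomial_mixture:
  assumes "pmf Q 0 = 0"
  shows "pmf (bind_pmf Q (\<lambda>n. neg_binomial_pmf n p)) x = nbm (pmf Q) p x"
proof -
  have "(\<lambda>n. pmf Q n * pmf (neg_binomial_pmf n p) x) sums pmf (bind_pmf Q (\<lambda>n. neg_binomial_pmf n p)) x"
    unfolding pmf_bind by (rule expectation_pmf_sums[of _ 1]) (simp add: pmf_le_1)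
  then have "(\<lambda>n. pmf Q (Suc n) * pmf (neg_binomial_pmf (Suc n) p) x)
      sums pmf (bind_pmf Q (\<lambda>n. neg_binomial_pmf n p)) x"
    using sums_Suc_iff[of "\<lambda>n. pmf Q n * pmf (neg_binomial_pmf n p) x"] assms by simp
  then show ?thesis by (simp add: nbm_def sums_iff)
qed

text \<open>
  Every claim size has positive probability.  This makes ruin possible in one step from every capital,
  as the uniqueness argument requires.
\<close>

lemma pmf_neg_binomial_mixture_pos:
  assumes p: "0 < p" "p < 1" and Q: "pmf Q 0 = 0"
  shows "0 < pmf (bind_pmf Q (\<lambda>n. neg_binomial_pmf n p)) y"
proof -
  obtain n where n: "n \<in> set_pmf Q" using set_pmf_not_empty[of Q] by blast
  with Q have "n \<noteq> 0" by (metis set_pmf_iff)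
  then have "0 < pmf (neg_binomial_pmf n p) y"
    using p by (simp add: pmf_neg_binomial)
  then have "y \<in> set_pmf (neg_binomial_pmf n p)"
    by (simp add: set_pmf_iff)
  with n have "y \<in> set_pmf (bind_pmf Q (\<lambda>n. neg_binomial_pmf n p))"
    unfolding set_bind_pmf by blast
  then show ?thesis by (simp add: pmf_positive)
qed

lemma expectation_neg_binomial_mixture:
  assumes p: "0 < p" "p < 1" and Q: "integrable (measure_pmf Q) real"
  shows "integrable (measure_pmf (bind_pmf Q (\<lambda>n. neg_binomial_pmf n p))) real"
    and "measure_pmf.expectation (bind_pmf Q (\<lambda>n. neg_binomial_pmf n p)) real
       = measure_pmf.expectation Q real * (1 - p) / p"
proof -
  let ?W = "bind_pmf Q (\<lambda>n. neg_binomial_pmf n p)" and ?e = "measure_pmf.expectation Q real * (1 - p) / p"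
  have "(\<integral>\<^sup>+y. ennreal (real y) \<partial>?W) = (\<integral>\<^sup>+n. ennreal (real n * (1 - p) / p) \<partial>Q)"
    using nn_integral_neg_binomial_pmf_real[of p] p by (simp flip: ennreal_of_nat_eq_real_of_nat)
  also have "\<dots> = ennreal (\<integral>n. real n * (1 - p) / p \<partial>Q)"
    by (rule nn_integral_eq_integral) (use Q p in auto)
  also have "(\<integral>n. real n * (1 - p) / p \<partial>Q) = ?e" by simp
  finally have nn: "(\<integral>\<^sup>+y. ennreal (real y) \<partial>?W) = ennreal ?e" .
  have e: "0 \<le> ?e" using p by simp
  show "integrable (measure_pmf ?W) real" "measure_pmf.expectation ?W real = ?e"
    using nn_integral_eq_integrable[of real "measure_pmf ?W" ?e] nn e by auto
qed

section \<open>The defective renewal equation\<close>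

text \<open>
  By this equation \<open>c k\<close> is the probability of reaching level \<open>k\<close> for a walk which moves up by \<open>i + 1\<close>
  with probability \<open>b i\<close> and is killed with the remaining probability \<open>1 - \<mu>\<close>.  A step of the walk that
  goes beyond the level meets \<open>c 0 = 1\<close> through truncated subtraction.  Monotonicity passes through the
  recursion by strong induction, starting from \<open>c 1 = \<mu> < c 0\<close>.  The limit \<open>l\<close> of the decreasing
  sequence satisfies \<open>l = \<mu> l\<close>, since dominated convergence allows the limit inside the series.
\<close>

lemma defective_renewal_bounds:
  fixes b c :: "nat \<Rightarrow> real"
  assumes b: "\<And>i. 0 \<le> b i" "b sums \<mu>" "\<mu> < 1"
    and c: "c 0 = 1" "\<And>k. c (Suc k) = (\<Sum>i. b i * c (k - i))"
  shows "0 \<le> c k" "c k \<le> 1" "decseq c" "c \<longlonglongrightarrow> 0"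
proof -
  have smb: "summable b" and smu: "suminf b = \<mu>" using b by (auto simp: sums_iff)
  have bounds: "0 \<le> c k \<and> c k \<le> 1" for k
  proof (induction k rule: less_induct)
    case (less k)
    show ?case
    proof (cases k)
      case 0
      with c show ?thesis by simp
    next
      case (Suc l)
      have *: "0 \<le> b i * c (l - i)" "b i * c (l - i) \<le> b i" for i
        using less[of "l - i"] b(1)[of i] Suc by (auto intro: mult_left_le)
      have sm: "summable (\<lambda>i. b i * c (l - i))"
        by (rule summable_comparison_test'[OF smb]) (use * in auto)
      have "(\<Sum>i. b i * c (l - i)) \<le> \<mu>"
        using suminf_le[OF *(2) sm smb] smu by simp
      moreover have "0 \<le> (\<Sum>i. b i * c (l - i))" by (intro suminf_nonneg sm *)
      ultimately show ?thesis using Suc c b by simp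
    qed
  qed
  then show "0 \<le> c k" "c k \<le> 1" by auto
  have bnd: "norm (b i * c j) \<le> b i" for i j
    using bounds[of j] b(1)[of i] by (simp add: abs_mult mult_left_le)
  have sm: "summable (\<lambda>i. b i * c (k - i))" for k
    by (rule summable_comparison_test'[OF smb])
       (use bnd in auto)
  have "c (Suc k) \<le> c k" for k
  proof (induction k rule: less_induct)
    case (less k)
    show ?case
    proof (cases k)
      case 0
      with bounds c(1) show ?thesis by simp
    next
      case (Suc l)
      have "c (Suc l - i) \<le> c (l - i)" for i
        using less[of "l - i"] Suc by (cases "i \<le> l") (auto simp: Suc_diff_le)
      then have "(\<Sum>i. b i * c (Suc l - i)) \<le> (\<Sum>i. b i * c (l - i))"
        by (intro suminf_le sm mult_left_mono b)
      then show ?thesis using Suc c(2) by simp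
    qed
  qed
  then show dec: "decseq c" by (intro decseq_SucI)
  have c0: "\<forall>i. 0 \<le> c i" using bounds by blast
  obtain l where l: "c \<longlonglongrightarrow> l"
    using decseq_convergent[OF dec c0] by blast
  have "(\<lambda>k. \<Sum>i. b i * c (k - i)) \<longlonglongrightarrow> (\<Sum>i. b i * l)"
  proof (rule tannerys_theorem[THEN conjunct2, THEN conjunct2])
    have "(\<lambda>k. c (k - i)) \<longlonglongrightarrow> l" for i
      by (rule LIMSEQ_offset[of _ i]) (simp add: l)
    then show "(\<lambda>k. b i * c (k - i)) \<longlonglongrightarrow> b i * l" for i
      by (intro tendsto_intros)
    show "\<forall>\<^sub>F (i, k) in sequentially \<times>\<^sub>F sequentially. norm (b i * c (k - i)) \<le> b i"
      by (intro always_eventually) (use bnd in auto)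
  qed (auto simp: smb)
  then have "(\<lambda>k. c (Suc k)) \<longlonglongrightarrow> \<mu> * l"
    using suminf_mult2[OF smb, of l] smu by (simp add: c(2))
  then have "l = \<mu> * l"
    using LIMSEQ_Suc[OF l] by (rule LIMSEQ_unique[rotated])
  then have "l * (1 - \<mu>) = 0" by (simp add: algebra_simps)
  with b(3) l show "c \<longlonglongrightarrow> 0" by simp
qed

text \<open>
  The equilibrium weights are tails of the distribution \<open>Q\<close>, so their differences are its weights, and
  subtracting consecutive instances of the recursion replaces a sum over tails by an expectation under \<open>Q\<close>.
  The condition \<open>pmf Q 0 = 0\<close> makes the leading tail equal to \<open>1\<close>, which produces the term \<open>c (k + 1)\<close>.
\<close>

lemma defective_renewal_difference:
  fixes c :: "nat \<Rightarrow> real"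
  assumes p: "0 < p" and Q: "pmf Q 0 = 0" and sm: "summable (tail (pmf Q))"
    and bounds: "\<And>k. 0 \<le> c k" "\<And>k. c k \<le> 1"
    and c: "\<And>k. c (Suc k) = (\<Sum>i. (1 - p) / p * tail (pmf Q) i * c (k - i))"
  shows "(1 - p) * measure_pmf.expectation Q (\<lambda>n. c (Suc k - n)) = c (Suc k) - p * c (Suc (Suc k))"
proof -
  let ?T = "tail (pmf Q)"
  note T = tail_pmf_nonneg[of Q]
  note T0 = tail_pmf_0[OF Q]
  have sm1: "summable (\<lambda>i. ?T i * c (k - i))" for k
    by (rule summable_comparison_test'[OF sm]) (use bounds T in \<open>auto simp: abs_mult intro: mult_left_le\<close>)
  have c': "p * c (Suc k) = (1 - p) * (\<Sum>i. ?T i * c (k - i))" for k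
    using p suminf_mult[OF sm1, of "(1 - p) / p" k] by (simp add: c[of k] mult.assoc)
  have sm2: "summable (\<lambda>i. ?T (Suc i) * c (k - i))"
    using sm1[of "Suc k"] summable_Suc_iff[of "\<lambda>i. ?T i * c (Suc k - i)"] by simp
  have split: "(\<Sum>i. ?T i * c (Suc k - i)) = c (Suc k) + (\<Sum>i. ?T (Suc i) * c (k - i))"
    using suminf_split_head[OF sm1[of "Suc k"]] T0 by simp
  have "(\<lambda>n. pmf Q n * c (Suc k - n)) sums measure_pmf.expectation Q (\<lambda>n. c (Suc k - n))"
    by (rule expectation_pmf_sums[of _ 1]) (use bounds in auto)
  then have "(\<lambda>n. pmf Q (Suc n) * c (k - n)) sums measure_pmf.expectation Q (\<lambda>n. c (Suc k - n))"
    using sums_Suc_iff[of "\<lambda>n. pmf Q n * c (Suc k - n)"] by (simp add: Q)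
  moreover have "(\<lambda>i. ?T i * c (k - i) - ?T (Suc i) * c (k - i)) sums
      ((\<Sum>i. ?T i * c (k - i)) - (\<Sum>i. ?T (Suc i) * c (k - i)))"
    by (intro sums_diff summable_sums sm1 sm2)
  moreover have "?T i * c (k - i) - ?T (Suc i) * c (k - i) = pmf Q (Suc i) * c (k - i)" for i
    using tail_pmf_Suc[of Q i] by (simp add: algebra_simps)
  ultimately have "measure_pmf.expectation Q (\<lambda>n. c (Suc k - n))
      = (\<Sum>i. ?T i * c (k - i)) - (\<Sum>i. ?T (Suc i) * c (k - i))"
    by (simp add: sums_iff)
  then have "(1 - p) * measure_pmf.expectation Q (\<lambda>n. c (Suc k - n))
      = (1 - p) * (\<Sum>i. ?T i * c (k - i)) - (1 - p) * (\<Sum>i. ?T (Suc i) * c (k - i))"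
    by (simp only: right_diff_distrib)
  moreover have "p * c (Suc (Suc k)) = (1 - p) * c (Suc k) + (1 - p) * (\<Sum>i. ?T (Suc i) * c (k - i))"
    using c'[of "Suc k"] by (simp only: split distrib_left)
  ultimately show ?thesis
    using c'[of k] left_diff_distrib[of 1 p "c (Suc k)"] by linarith
qed

text \<open>
  The recursion with normalised weights \<open>fe\<close> and a separate tail term is the renewal equation in disguise:
  the tail collects the terms \<open>i \<ge> k\<close>, where the shifted sequence has the value \<open>1\<close>, and \<open>C 0 / m = r\<close>
  undoes the normalisation.
\<close>

lemma equilibrium_recursion:
  fixes T C fe :: "nat \<Rightarrow> real"
  assumes T: "T sums m" and m: "m \<noteq> 0"
    and fe: "\<And>i. 1 \<le> i \<Longrightarrow> fe i = T (i - 1) / m"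
    and C_0: "C 0 = m * r"
    and C_rec: "\<And>k. 1 \<le> k \<Longrightarrow> C k = C 0 * ((\<Sum>i=1..k. fe i * C (k - i)) + tail fe k)"
  shows "C k = (\<Sum>i. r * T i * (case k - i of 0 \<Rightarrow> 1 | Suc l \<Rightarrow> C l))"
proof (cases "k = 0")
  case True
  have "(\<lambda>i. r * T i) sums (r * m)" by (rule sums_mult[OF T])
  with True C_0 show ?thesis by (simp add: sums_iff mult.commute)
next
  case False
  let ?g = "\<lambda>i. r * T i * (case k - i of 0 \<Rightarrow> 1 | Suc l \<Rightarrow> C l)"
  have fe': "C 0 * fe (Suc i) = r * T i" for i
    using fe[of "Suc i"] m C_0 by simp
  have sm: "summable (\<lambda>i. r * T (i + k))"
    by (intro summable_mult summable_ignore_initial_segment sums_summable[OF T])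
  have sm_g: "summable (\<lambda>i. ?g (i + k))" using sm by simp
  have sm_fe: "summable (\<lambda>i. fe (Suc k + i))"
    using summable_mult[OF summable_ignore_initial_segment[OF sums_summable[OF T], of k], of "1 / m"] fe
    by (simp add: add.commute)
  have "C 0 * tail fe k = (\<Sum>i. C 0 * fe (Suc k + i))"
    unfolding tail_def by (rule suminf_mult[OF sm_fe, symmetric])
  also have "\<dots> = (\<Sum>i. ?g (i + k))"
    using fe' by (simp add: add.commute)
  finally have tl: "C 0 * tail fe k = (\<Sum>i. ?g (i + k))" .
  have "C 0 * (\<Sum>i=1..k. fe i * C (k - i)) = (\<Sum>i<k. C 0 * fe (Suc i) * C (k - Suc i))"
    by (simp add: sum.atLeast1_atMost_eq sum_distrib_left mult.assoc)
  also have "\<dots> = (\<Sum>i<k. ?g i)"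
    unfolding fe' by (intro sum.cong refl) (auto simp: Suc_diff_Suc[symmetric])
  finally have "C k = (\<Sum>i. ?g (i + k)) + (\<Sum>i<k. ?g i)"
    using False C_rec[of k] tl by (simp add: distrib_left)
  also have "\<dots> = suminf ?g"
    by (rule suminf_split_initial_segment[symmetric]) (rule iffD1[OF summable_iff_shift sm_g])
  finally show ?thesis .
qed

section \<open>One claim preserves the mixture\<close>

text \<open>
  The candidate for the ruin probability.  With \<open>v = 0\<close> representing ruin, its value there is \<open>1\<close>; the
  formula for \<open>v \<ge> 1\<close> would give \<open>c 1\<close> at \<open>v = 0\<close>.
\<close>

definition mixed_ruin :: "real \<Rightarrow> (nat \<Rightarrow> real) \<Rightarrow> nat \<Rightarrow> real" where
  "mixed_ruin p c v = (if v = 0 then 1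
     else measure_pmf.expectation (neg_binomial_pmf v (1 - p)) (\<lambda>k. c (Suc k)))"

lemma mixed_ruin_0 [simp]: "mixed_ruin p c 0 = 1"
  by (simp add: mixed_ruin_def)

lemma mixed_ruin_unit_interval:
  assumes "\<And>k. 0 \<le> c k" "\<And>k. c k \<le> 1"
  shows "0 \<le> mixed_ruin p c v" "mixed_ruin p c v \<le> 1"
  using expectation_pmf_unit_interval[of "\<lambda>k. c (Suc k)"] assms by (auto simp: mixed_ruin_def)

text \<open>
  Both sides describe the same sequence of trials.  On the left the trials run until the \<open>n\<close>-th success; if
  \<open>y < v\<close> failures have occurred, they go on until the \<open>v\<close>-th failure.  On the right they run until the
  \<open>v\<close>-th failure at once, and \<open>k\<close> counts all successes, of which \<open>n\<close> precede the stop on the left.  If the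
  \<open>v\<close>-th failure comes before the \<open>n\<close>-th success, both sides have the value \<open>1\<close>.  Formally, both sides satisfy
  the recursion obtained by conditioning on the first trial.  For \<open>n = v = 0\<close> they are \<open>1\<close> and \<open>c 1\<close>, so
  that case is excluded.
\<close>

lemma neg_binomial_duality:
  fixes c :: "nat \<Rightarrow> real"
  assumes p: "0 < p" "p < 1" and c: "\<And>k. 0 \<le> c k" "\<And>k. c k \<le> 1" "c 0 = 1"
    and nv: "0 < n \<or> 0 < v"
  shows "measure_pmf.expectation (neg_binomial_pmf n p) (\<lambda>y. mixed_ruin p c (v - y))
       = measure_pmf.expectation (neg_binomial_pmf v (1 - p)) (\<lambda>k. c (Suc k - n))"
  using nv
proof (induction "n + v" arbitrary: n v rule: less_induct)
  case (less n v)
  let ?w = "mixed_ruin p c"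
  have cB: "\<bar>c k\<bar> \<le> 1" and wB: "\<bar>?w k\<bar> \<le> 1" for k
    using c mixed_ruin_unit_interval[of c p k] by auto
  show ?case
  proof (cases "n = 0 \<or> v = 0")
    case True
    with less.prems show ?thesis using c by (auto simp: mixed_ruin_def)
  next
    case False
    then obtain n' v' where nv: "n = Suc n'" "v = Suc v'"
      by (auto simp: gr0_conv_Suc)
    have "measure_pmf.expectation (neg_binomial_pmf n p) (\<lambda>y. ?w (v - y))
        = p * measure_pmf.expectation (neg_binomial_pmf n' p) (\<lambda>y. ?w (v - y))
        + (1 - p) * measure_pmf.expectation (neg_binomial_pmf n p) (\<lambda>y. ?w (v' - y))"
      unfolding nv by (subst expectation_neg_binomial_Suc[OF p wB]) simp
    also have "\<dots> = p * measure_pmf.expectation (neg_binomial_pmf v (1 - p)) (\<lambda>k. c (Suc k - n'))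
        + (1 - p) * measure_pmf.expectation (neg_binomial_pmf v' (1 - p)) (\<lambda>k. c (Suc k - n))"
      using less.hyps[of n' v] less.hyps[of n v'] by (simp add: nv)
    also have "\<dots> = measure_pmf.expectation (neg_binomial_pmf v (1 - p)) (\<lambda>k. c (Suc k - n))"
      unfolding nv
      using expectation_neg_binomial_Suc[of "1 - p" "\<lambda>k. c (Suc k - Suc n')" 1 v'] p cB
      by simp
    finally show ?thesis .
  qed
qed

text \<open>
  Duality moves the claim inside the mixture, where it shifts the argument of \<open>c\<close> by \<open>n\<close>.  The difference
  equation evaluates the mean of the shifted sequence, and conditioning on the first trial brings the result
  back from \<open>u + 1\<close> to \<open>u\<close> failures.
\<close>

lemma mixed_ruin_harmonic:
  fixes c :: "nat \<Rightarrow> real"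
  assumes p: "0 < p" "p < 1" and c: "\<And>k. 0 \<le> c k" "\<And>k. c k \<le> 1" "c 0 = 1"
    and diff: "\<And>k. (1 - p) * measure_pmf.expectation Q (\<lambda>n. c (Suc k - n)) = c (Suc k) - p * c (Suc (Suc k))"
    and u: "1 \<le> u"
  shows "mixed_ruin p c u
       = measure_pmf.expectation (bind_pmf Q (\<lambda>n. neg_binomial_pmf n p)) (\<lambda>y. mixed_ruin p c (Suc u - y))"
proof -
  let ?w = "mixed_ruin p c" and ?Z = "\<lambda>v. neg_binomial_pmf v (1 - p)"
  have cB: "\<bar>c k\<bar> \<le> 1" and wB: "\<bar>?w k\<bar> \<le> 1" for k
    using c mixed_ruin_unit_interval[of c p k] by auto
  have int: "integrable (measure_pmf R) (\<lambda>k. c (g k))" for R :: "nat pmf" and g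
    by (rule integrable_pmf_bounded[OF cB])
  have "measure_pmf.expectation (bind_pmf Q (\<lambda>n. neg_binomial_pmf n p)) (\<lambda>y. ?w (Suc u - y))
      = measure_pmf.expectation Q (\<lambda>n. measure_pmf.expectation (?Z (Suc u)) (\<lambda>k. c (Suc k - n)))"
    by (subst expectation_bind_pmf[OF wB]) (simp add: neg_binomial_duality[of p c, OF p c])
  also have "\<dots> = measure_pmf.expectation (?Z (Suc u)) (\<lambda>k. measure_pmf.expectation Q (\<lambda>n. c (Suc k - n)))"
    by (rule expectation_pmf_swap[OF cB])
  finally have "(1 - p) * measure_pmf.expectation (bind_pmf Q (\<lambda>n. neg_binomial_pmf n p)) (\<lambda>y. ?w (Suc u - y))
      = (1 - p) * measure_pmf.expectation (?Z (Suc u)) (\<lambda>k. measure_pmf.expectation Q (\<lambda>n. c (Suc k - n)))"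
    by (rule arg_cong)
  also have "\<dots> = measure_pmf.expectation (?Z (Suc u)) (\<lambda>k. c (Suc k) - p * c (Suc (Suc k)))"
    by (simp only: diff[symmetric] integral_mult_right_zero)
  also have "\<dots> = measure_pmf.expectation (?Z (Suc u)) (\<lambda>k. c (Suc k))
      - p * measure_pmf.expectation (?Z (Suc u)) (\<lambda>k. c (Suc (Suc k)))"
    by (simp add: int)
  also have "\<dots> = (1 - p) * ?w u"
    using expectation_neg_binomial_Suc[of "1 - p" "\<lambda>k. c (Suc k)" 1 u] p cB u
    by (simp add: mixed_ruin_def)
  finally show ?thesis using p by simp
qed

section \<open>Uniqueness of the ruin function\<close>

text \<open>
  The probability of ruin within \<open>t\<close> periods depends only on the claim distribution.  Defining it by
  conditioning on the first claim separates the uniqueness argument from the risk process; capital \<open>0\<close> is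
  an absorbing state that stands for ruin (\<open>prob_ruined_within\<close> connects it with the process).
\<close>

primrec finite_horizon_ruin :: "nat pmf \<Rightarrow> nat \<Rightarrow> nat \<Rightarrow> real" where
  "finite_horizon_ruin W 0 u = (if u = 0 then 1 else 0)"
| "finite_horizon_ruin W (Suc t) u = (if u = 0 then 1
     else measure_pmf.expectation W (\<lambda>y. finite_horizon_ruin W t (Suc u - y)))"

lemma finite_horizon_ruin_0 [simp]: "finite_horizon_ruin W t 0 = 1"
  by (cases t) auto

lemma finite_horizon_ruin_unit_interval:
  "0 \<le> finite_horizon_ruin W t u \<and> finite_horizon_ruin W t u \<le> 1"
proof (induction t arbitrary: u)
  case (Suc t)
  then show ?case
    using expectation_pmf_unit_interval[of "\<lambda>y. finite_horizon_ruin W t (Suc u - y)" W] by auto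
qed auto

lemma finite_horizon_ruin_bounded: "\<bar>finite_horizon_ruin W t u\<bar> \<le> 1"
  using finite_horizon_ruin_unit_interval[of W t u] by auto

lemma finite_horizon_ruin_incseq: "incseq (\<lambda>t. finite_horizon_ruin W t u)"
proof (rule incseq_SucI)
  show "finite_horizon_ruin W t u \<le> finite_horizon_ruin W (Suc t) u" for t
  proof (induction t arbitrary: u)
    case 0
    show ?case using finite_horizon_ruin_unit_interval[of W "Suc 0" u] by simp
  next
    case (Suc t)
    show ?case
    proof (cases "u = 0")
      case False
      then show ?thesis
        unfolding finite_horizon_ruin.simps(2)[of W t u] finite_horizon_ruin.simps(2)[of W "Suc t" u]
        by (simp only: if_False)
           (rule expectation_pmf_mono[OF finite_horizon_ruin_bounded finite_horizon_ruin_bounded Suc.IH])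
    qed simp
  qed
qed

lemma nonneg_null_sequence_attains_Max:
  fixes d :: "nat \<Rightarrow> real"
  assumes "d \<longlonglongrightarrow> 0" "0 < d k"
  obtains m where "0 < d m" "\<And>n. d n \<le> d m"
proof -
  obtain K where K: "\<And>n. K \<le> n \<Longrightarrow> d n < d k"
    using order_tendstoD(2)[OF assms] by (auto simp: eventually_sequentially)
  have fin: "finite (d ` {..max k K})" by simp
  have "Max (d ` {..max k K}) \<in> d ` {..max k K}" by (rule Max_in[OF fin]) auto
  then obtain m where m: "Max (d ` {..max k K}) = d m" by (rule imageE)
  have le: "d n \<le> d m" if "n \<le> max k K" for n
    unfolding m[symmetric] by (rule Max_ge[OF fin]) (use that in auto)
  show ?thesis
  proof (rule that[of m])
    show "0 < d m" using le[of k] assms(2) by simp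
    show "d n \<le> d m" for n
      using le[of n] le[of k] K[of n] by (cases "n \<le> max k K") (auto simp: not_le)
  qed
qed

text \<open>
  The one-step equation determines a null sequence \<open>w\<close>, by a maximum principle applied to the difference
  \<open>d\<close> between \<open>w\<close> and the limit of the finite-horizon probabilities.  The hypothesis that \<open>w\<close> vanishes at
  infinity guarantees that a positive \<open>d\<close> attains its maximum; it excludes the constant
  solution \<open>1\<close>.
\<close>

lemma finite_horizon_ruin_tendsto:
  fixes w :: "nat \<Rightarrow> real"
  assumes W: "\<And>y. 0 < pmf W y" and w0: "w 0 = 1" and w: "\<And>u. 0 \<le> w u" "\<And>u. w u \<le> 1"
    and harmonic: "\<And>u. 1 \<le> u \<Longrightarrow> w u = measure_pmf.expectation W (\<lambda>y. w (Suc u - y))"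
    and lim: "w \<longlonglongrightarrow> 0"
  shows "(\<lambda>t. finite_horizon_ruin W t u) \<longlonglongrightarrow> w u"
proof -
  let ?f = "finite_horizon_ruin W"
  have wB: "\<bar>w u\<bar> \<le> 1" for u using w[of u] by auto
  have f_le: "?f t u \<le> w u" for t u
  proof (induction t arbitrary: u)
    case 0
    then show ?case using w w0 by simp
  next
    case (Suc t)
    have "measure_pmf.expectation W (\<lambda>y. ?f t (Suc u - y)) \<le> measure_pmf.expectation W (\<lambda>y. w (Suc u - y))"
      by (rule expectation_pmf_mono[OF finite_horizon_ruin_bounded wB Suc.IH])
    then show ?case using w0 harmonic[of u] by (cases "u = 0") auto
  qed
  have "\<exists>l. (\<lambda>t. ?f t u) \<longlonglongrightarrow> l" for u
    using incseq_convergent[OF finite_horizon_ruin_incseq[of W u], of 1]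
      finite_horizon_ruin_unit_interval by metis
  then obtain g where g: "\<And>u. (\<lambda>t. ?f t u) \<longlonglongrightarrow> g u" by metis
  have g01: "0 \<le> g u" "g u \<le> w u" for u
    using LIMSEQ_le_const[OF g, of 0 u] LIMSEQ_le_const2[OF g, of u "w u"] f_le
      finite_horizon_ruin_unit_interval by auto
  have gB: "\<bar>g u\<bar> \<le> 1" for u using g01[of u] w[of u] by auto
  have g0: "g 0 = 1" using LIMSEQ_unique[OF g[of 0]] by simp
  have g_harmonic: "g u = measure_pmf.expectation W (\<lambda>y. g (Suc u - y))" if "1 \<le> u" for u
  proof (rule LIMSEQ_unique[OF LIMSEQ_Suc[OF g]])
    have "(\<lambda>t. measure_pmf.expectation W (\<lambda>y. ?f t (Suc u - y)))
        \<longlonglongrightarrow> measure_pmf.expectation W (\<lambda>y. g (Suc u - y))"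
      by (rule integral_dominated_convergence[where w = "\<lambda>_. 1"])
         (use g finite_horizon_ruin_bounded in auto)
    then show "(\<lambda>t. ?f (Suc t) u) \<longlonglongrightarrow> measure_pmf.expectation W (\<lambda>y. g (Suc u - y))"
      using that by simp
  qed
  define d where "d u = w u - g u" for u
  have d0: "d 0 = 0" using w0 g0 by (simp add: d_def)
  have d_nonneg: "0 \<le> d u" "d u \<le> w u" for u using g01[of u] by (auto simp: d_def)
  have dB: "\<bar>d u\<bar> \<le> 1" for u using d_nonneg[of u] w[of u] by auto
  have d_harmonic: "d u = measure_pmf.expectation W (\<lambda>y. d (Suc u - y))" if "1 \<le> u" for u
    unfolding d_def using harmonic[OF that] g_harmonic[OF that]
    by (subst Bochner_Integration.integral_diff) (auto intro: integrable_pmf_bounded wB gB)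
  have d_lim: "d \<longlonglongrightarrow> 0"
    by (rule tendsto_sandwich[OF _ _ tendsto_const lim]) (use d_nonneg in auto)
  have "d u = 0"
  proof (rule ccontr)
    assume "d u \<noteq> 0"
    with d_nonneg[of u] have "0 < d u" by simp
    then obtain m where m: "0 < d m" "\<And>n. d n \<le> d m"
      using nonneg_null_sequence_attains_Max[OF d_lim] by blast
    then have "m \<noteq> 0" using d0 by (cases m) auto
    then have "measure_pmf.expectation W (\<lambda>y. d m - d (Suc m - y)) = 0"
      using d_harmonic[of m]
      by (subst Bochner_Integration.integral_diff) (auto intro: integrable_pmf_bounded dB)
    moreover have "\<bar>d m - d n\<bar> \<le> 1" for n
      using m(2)[of n] d_nonneg[of n] dB[of m] by auto
    then have "integrable (measure_pmf W) (\<lambda>y. d m - d (Suc m - y))"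
      by (rule integrable_pmf_bounded)
    ultimately have "AE y in W. d m - d (Suc m - y) = 0"
      using m(2) by (subst (asm) integral_nonneg_eq_0_iff_AE) auto
    \<comment> \<open>A claim of size \<open>m + 1\<close> leads from capital \<open>m\<close> exactly to ruin.\<close>
    then have "d m - d (Suc m - Suc m) = 0"
      unfolding AE_measure_pmf_iff by (rule bspec) (use W[of "Suc m"] in \<open>simp add: set_pmf_iff\<close>)
    with d0 m(1) show False by simp
  qed
  then show ?thesis using g[of u] by (simp add: d_def)
qed

section \<open>Ruin of the risk process\<close>

text \<open>
  The path \<open>x\<close> lists the claims from the current period on.  The range of \<open>s\<close> includes \<open>0\<close>, so that
  capital \<open>0\<close> counts as ruined; for positive capital this adds nothing, and the condition is that of ruin.
\<close>

definition ruined_within :: "nat \<Rightarrow> nat \<Rightarrow> (nat \<Rightarrow> nat) \<Rightarrow> bool" where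
  "ruined_within t u x \<longleftrightarrow> (\<exists>s\<le>t. u + s \<le> (\<Sum>i<s. x i))"

lemma ruined_within_0_capital [simp]: "ruined_within t 0 x"
  unfolding ruined_within_def by (rule exI[of _ 0]) simp

text \<open>
  The first claim moves the capital to \<open>u + 1 - x 0\<close>.  Truncation at \<open>0\<close> records ruin by the first claim.
\<close>

lemma ruined_within_Suc:
  assumes "1 \<le> u"
  shows "ruined_within (Suc t) u x \<longleftrightarrow> ruined_within t (Suc u - x 0) (\<lambda>i. x (Suc i))"
proof -
  have "ruined_within (Suc t) u x \<longleftrightarrow> (\<exists>s\<le>t. u + Suc s \<le> (\<Sum>i<Suc s. x i))"
  proof
    assume "ruined_within (Suc t) u x"
    then obtain s where s: "s \<le> Suc t" "u + s \<le> (\<Sum>i<s. x i)" by (auto simp: ruined_within_def)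
    with assms show "\<exists>s\<le>t. u + Suc s \<le> (\<Sum>i<Suc s. x i)"
      by (cases s) auto
  qed (auto simp: ruined_within_def)
  also have "\<dots> \<longleftrightarrow> (\<exists>s\<le>t. Suc u + s \<le> x 0 + (\<Sum>i<s. x (Suc i)))"
    by (simp only: sum.lessThan_Suc_shift) simp
  also have "\<dots> \<longleftrightarrow> ruined_within t (Suc u - x 0) (\<lambda>i. x (Suc i))"
  proof (cases "x 0 \<le> Suc u")
    case True
    then show ?thesis by (auto simp: ruined_within_def)
  next
    case False
    then have "\<exists>s\<le>t. Suc u + s \<le> x 0 + (\<Sum>i<s. x (Suc i))" by (intro exI[of _ 0]) auto
    with False show ?thesis by simp
  qed
  finally show ?thesis .
qed

lemma sets_ruined_within:
  assumes "\<And>i. (\<lambda>\<omega>. X i \<omega>) \<in> measurable M (count_space UNIV)"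
  shows "{\<omega> \<in> space M. ruined_within t u (\<lambda>i. X i \<omega>)} \<in> sets M"
proof -
  have [measurable]: "(\<lambda>\<omega>. real (X i \<omega>)) \<in> borel_measurable M" for i
    using measurable_compose[OF assms[of i], of real borel] by simp
  have "{\<omega> \<in> space M. ruined_within t u (\<lambda>i. X i \<omega>)}
      = {\<omega> \<in> space M. \<exists>s\<in>{..t}. real (u + s) \<le> (\<Sum>i<s. real (X i \<omega>))}"
    unfolding ruined_within_def by (auto simp flip: of_nat_sum of_nat_add)
  also have "\<dots> \<in> sets M" by measurable
  finally show ?thesis .
qed

text \<open>
  The first claim is independent of the later ones, and these form a sequence of the same kind.  The
  starting index \<open>m\<close> is arbitrary so that the induction hypothesis covers the later claims.
\<close>

lemma (in prob_space) prob_ruined_within: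
  fixes Y :: "nat \<Rightarrow> 'a \<Rightarrow> nat"
  assumes indep: "indep_vars (\<lambda>_. count_space UNIV) Y {1..}"
    and distr: "\<And>i. 1 \<le> i \<Longrightarrow> distr M (count_space UNIV) (Y i) = measure_pmf W"
    and m: "1 \<le> m"
  shows "prob {\<omega> \<in> space M. ruined_within t u (\<lambda>i. Y (m + i) \<omega>)} = finite_horizon_ruin W t u"
  using m
proof (induction t arbitrary: m u)
  case 0
  show ?case by (simp add: ruined_within_def prob_space)
next
  case (Suc t)
  have meas: "Y i \<in> measurable M (count_space UNIV)" if "1 \<le> i" for i
    using indep that unfolding indep_vars_def by auto
  show ?case
  proof (cases "u = 0")
    case True
    then show ?thesis by (simp add: prob_space)
  next
    case False
    define R where "R v = {\<omega> \<in> space M. ruined_within t v (\<lambda>i. Y (Suc m + i) \<omega>)}" for v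
    define A where "A y = {\<omega> \<in> space M. Y m \<omega> = y} \<inter> R (Suc u - y)" for y
    have R_sets: "R v \<in> events" for v
      unfolding R_def by (rule sets_ruined_within, rule meas) simp
    have Ym_sets: "{\<omega> \<in> space M. Y m \<omega> = y} \<in> events" for y
      using measurable_sets[OF meas[OF Suc.prems], of "{y}"] by (simp add: vimage_def Int_def conj_commute)
    have Ym_prob: "prob {\<omega> \<in> space M. Y m \<omega> = y} = pmf W y" for y
      using measure_distr[OF meas[OF Suc.prems], of "{y}"] distr[OF Suc.prems]
      by (simp add: vimage_def Int_def conj_commute measure_pmf_single)
    have A_prob: "prob (A y) = pmf W y * finite_horizon_ruin W t (Suc u - y)" for y
    proof -
      let ?P = "\<lambda>B. PiM B (\<lambda>_. count_space (UNIV :: nat set))"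
      let ?E = "{x \<in> space (?P {m}). x m = y}"
      let ?F = "{x \<in> space (?P {Suc m..}). ruined_within t (Suc u - y) (\<lambda>i. x (Suc m + i))}"
      have "indep_var (?P {m}) (\<lambda>\<omega>. restrict (\<lambda>i. Y i \<omega>) {m}) (?P {Suc m..}) (\<lambda>\<omega>. restrict (\<lambda>i. Y i \<omega>) {Suc m..})"
        by (rule indep_var_restrict[OF indep]) (use Suc.prems in auto)
      moreover have "?E \<in> sets (?P {m})"
        using measurable_sets[OF measurable_component_singleton[of m "{m}" "\<lambda>_. count_space UNIV"], of "{y}"]
        by (simp add: vimage_def Int_def conj_commute)
      moreover have "?F \<in> sets (?P {Suc m..})"
        by (rule sets_ruined_within, rule measurable_component_singleton) simp
      ultimately have "prob ((\<lambda>\<omega>. (restrict (\<lambda>i. Y i \<omega>) {m}, restrict (\<lambda>i. Y i \<omega>) {Suc m..})) -` (?E \<times> ?F) \<inter> space M)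
          = prob ((\<lambda>\<omega>. restrict (\<lambda>i. Y i \<omega>) {m}) -` ?E \<inter> space M)
          * prob ((\<lambda>\<omega>. restrict (\<lambda>i. Y i \<omega>) {Suc m..}) -` ?F \<inter> space M)"
        by (rule indep_varD)
      also have "(\<lambda>\<omega>. (restrict (\<lambda>i. Y i \<omega>) {m}, restrict (\<lambda>i. Y i \<omega>) {Suc m..})) -` (?E \<times> ?F) \<inter> space M = A y"
        by (auto simp: A_def R_def space_PiM)
      also have "(\<lambda>\<omega>. restrict (\<lambda>i. Y i \<omega>) {m}) -` ?E \<inter> space M = {\<omega> \<in> space M. Y m \<omega> = y}"
        by (auto simp: space_PiM)
      also have "(\<lambda>\<omega>. restrict (\<lambda>i. Y i \<omega>) {Suc m..}) -` ?F \<inter> space M = R (Suc u - y)"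
        by (auto simp: R_def space_PiM)
      finally show ?thesis
        using Suc.IH[of "Suc m" "Suc u - y"] by (simp add: Ym_prob R_def)
    qed
    have "{\<omega> \<in> space M. ruined_within (Suc t) u (\<lambda>i. Y (m + i) \<omega>)} = (\<Union>y. A y)"
      using False by (auto simp: ruined_within_Suc A_def R_def)
    moreover have "(\<lambda>y. prob (A y)) sums prob (\<Union>y. A y)"
      by (rule finite_measure_UNION)
         (use R_sets Ym_sets in \<open>auto simp: A_def disjoint_family_on_def\<close>)
    moreover have "(\<lambda>y. prob (A y)) sums measure_pmf.expectation W (\<lambda>y. finite_horizon_ruin W t (Suc u - y))"
      unfolding A_prob by (rule expectation_pmf_sums[OF finite_horizon_ruin_bounded])
    ultimately show ?thesis
      using False by (simp add: sums_unique2)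
  qed
qed

lemma ruin_time_finite_iff:
  assumes "1 \<le> u"
  shows "ruin_time Y u \<omega> < \<infinity> \<longleftrightarrow> (\<exists>t. ruined_within t u (\<lambda>i. Y (1 + i) \<omega>))"
proof -
  have "ruin_time Y u \<omega> < \<infinity> \<longleftrightarrow> (\<exists>t. 1 \<le> t \<and> risk_process Y u t \<omega> \<le> 0)"
    unfolding ruin_time_def INF_less_iff by simp
  also have "\<dots> \<longleftrightarrow> (\<exists>t. 1 \<le> t \<and> u + t \<le> (\<Sum>i<t. Y (1 + i) \<omega>))"
  proof -
    have sum: "(\<Sum>i=1..t. int (Y i \<omega>)) = int (\<Sum>i<t. Y (1 + i) \<omega>)" for t
      by (simp add: sum.atLeast1_atMost_eq)
    have "risk_process Y u t \<omega> \<le> 0 \<longleftrightarrow> u + t \<le> (\<Sum>i<t. Y (1 + i) \<omega>)" for t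
      using sum[of t] unfolding risk_process_def by linarith
    then show ?thesis by simp
  qed
  also have "\<dots> \<longleftrightarrow> (\<exists>t. u + t \<le> (\<Sum>i<t. Y (1 + i) \<omega>))"
    using assms by (metis One_nat_def Suc_leI add.right_neutral lessThan_0 not_gr_zero not_one_le_zero le_zero_eq sum.empty)
  also have "\<dots> \<longleftrightarrow> (\<exists>t. ruined_within t u (\<lambda>i. Y (1 + i) \<omega>))"
    by (auto simp: ruined_within_def)
  finally show ?thesis .
qed

lemma (in prob_space) finite_horizon_ruin_tendsto_ruin_prob:
  fixes Y :: "nat \<Rightarrow> 'a \<Rightarrow> nat"
  assumes indep: "indep_vars (\<lambda>_. count_space UNIV) Y {1..}"
    and distr: "\<And>i. 1 \<le> i \<Longrightarrow> distr M (count_space UNIV) (Y i) = measure_pmf W"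
    and u: "1 \<le> u"
  shows "(\<lambda>t. finite_horizon_ruin W t u) \<longlonglongrightarrow> ruin_prob M Y u"
proof -
  let ?A = "\<lambda>t. {\<omega> \<in> space M. ruined_within t u (\<lambda>i. Y (1 + i) \<omega>)}"
  have meas: "Y i \<in> measurable M (count_space UNIV)" if "1 \<le> i" for i
    using indep that unfolding indep_vars_def by auto
  have "range ?A \<subseteq> events"
    by (intro image_subsetI sets_ruined_within, rule meas) simp
  moreover have "incseq ?A"
    by (auto simp: incseq_def ruined_within_def intro: order_trans)
  ultimately have "(\<lambda>t. prob (?A t)) \<longlonglongrightarrow> prob (\<Union>t. ?A t)"
    by (rule finite_Lim_measure_incseq)
  moreover have "(\<Union>t. ?A t) = {\<omega> \<in> space M. ruin_time Y u \<omega> < \<infinity>}"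
    unfolding ruin_time_finite_iff[OF u] by auto
  ultimately show ?thesis
    by (simp only: ruin_prob_def prob_ruined_within[OF indep distr order_refl])
qed

section \<open>The ruin probability as a negative binomial mixture\<close>

theorem theorem3p5:
  fixes p :: real
    and P :: "'a measure" and N :: "'a \<Rightarrow> nat" and f\<^sub>N :: "nat \<Rightarrow> real"
    and M :: "'b measure" and Y :: "nat \<Rightarrow> 'b \<Rightarrow> nat"
    and R :: "'c measure" and Z :: "'c \<Rightarrow> nat" and u :: nat
    and f\<^sub>N\<^sub>e :: "nat \<Rightarrow> real" and C :: "nat \<Rightarrow> real"
  assumes p: "0 < p" "p < 1"
    and P: "prob_space P"
    and N: "N \<in> measurable P (count_space UNIV)"
    and N_pos: "\<And>\<omega>. \<omega> \<in> space P \<Longrightarrow> 1 \<le> N \<omega>"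
    and N_int: "integrable P (\<lambda>\<omega>. real (N \<omega>))"
    and f\<^sub>N: "\<And>k. f\<^sub>N k = measure P {\<omega> \<in> space P. N \<omega> = k}"
    and M: "prob_space M"
    and Y_indep: "prob_space.indep_vars M (\<lambda>_. count_space UNIV) Y {1..}"
    and Y_nbm: "\<And>i. 1 \<le> i \<Longrightarrow> distributed M (count_space UNIV) (Y i) (\<lambda>x. ennreal (nbm f\<^sub>N p x))"
    and net_profit: "(\<integral>\<omega>. real (Y 1 \<omega>) \<partial>M) < 1"
    and u: "1 \<le> u"
    and R: "prob_space R"
    and Z: "distributed R (count_space UNIV) Z (\<lambda>x. ennreal (pmf (neg_binomial_pmf u (1 - p)) x))"
    and f\<^sub>N\<^sub>e: "\<And>i. 1 \<le> i \<Longrightarrow> f\<^sub>N\<^sub>e i = tail f\<^sub>N (i - 1) / (\<integral>\<omega>. real (N \<omega>) \<partial>P)"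
    and C_0: "C 0 = (\<integral>\<omega>. real (N \<omega>) \<partial>P) * (1 - p) / p"
    and C_rec: "\<And>k. 1 \<le> k \<Longrightarrow> C k = C 0 * ((\<Sum>i=1..k. f\<^sub>N\<^sub>e i * C (k - i)) + tail f\<^sub>N\<^sub>e k)"
  shows "integrable M (\<lambda>\<omega>. real (Y 1 \<omega>)) \<and>
    (\<integral>\<omega>. real (Y 1 \<omega>) \<partial>M) = (\<integral>\<omega>. real (N \<omega>) \<partial>P) * (1 - p) / p \<and>
    (\<lambda>k. C k * measure R {\<omega> \<in> space R. Z \<omega> = k}) sums ruin_prob M Y u \<and>
    integrable R (\<lambda>\<omega>. C (Z \<omega>)) \<and>
    ruin_prob M Y u = (\<integral>\<omega>. C (Z \<omega>) \<partial>R)"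
proof -
  interpret M: prob_space M by (rule M)
  obtain Q where Q: "distr P (count_space UNIV) N = measure_pmf Q"
    using nat_random_variable_has_pmf[OF P N] .
  note N_transfer = distr_eq_pmf_transfer[OF N Q]
  define m where "m = measure_pmf.expectation Q real"
  have m: "(\<integral>\<omega>. real (N \<omega>) \<partial>P) = m" by (simp add: m_def N_transfer(3))
  have Q_int: "integrable (measure_pmf Q) real" using N_int by (simp add: N_transfer(2))
  have fN: "f\<^sub>N = pmf Q" using f\<^sub>N N_transfer(1) by auto
  have no_zero: "{\<omega> \<in> space P. N \<omega> = 0} = {}" using N_pos by fastforce
  have Q0: "pmf Q 0 = 0" using N_transfer(1)[of 0] unfolding no_zero by simp
  define W where "W = bind_pmf Q (\<lambda>n. neg_binomial_pmf n p)"
  have Y_meas: "Y i \<in> measurable M (count_space UNIV)"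
    and Y_distr: "distr M (count_space UNIV) (Y i) = measure_pmf W" if "1 \<le> i" for i
    using distributed_measurable[OF Y_nbm[OF that]]
      distributed_pmf_distr[of M "Y i" W] Y_nbm[OF that]
    by (auto simp: W_def pmf_neg_binomial_mixture[OF Q0] fN)
  note Y_transfer = distr_eq_pmf_transfer[OF Y_meas Y_distr, OF order_refl order_refl]
  have mean_Y: "(\<integral>\<omega>. real (Y 1 \<omega>) \<partial>M) = m * (1 - p) / p"
    using expectation_neg_binomial_mixture(2)[OF p Q_int] Y_transfer(3)[of real] by (simp add: W_def m_def)
  have int_Y: "integrable M (\<lambda>\<omega>. real (Y 1 \<omega>))"
    using expectation_neg_binomial_mixture(1)[OF p Q_int] Y_transfer(2)[of real] by (simp add: W_def)

  define c where "c n = (case n of 0 \<Rightarrow> 1 | Suc k \<Rightarrow> C k)" for n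
  have c_simps [simp]: "c 0 = 1" "c (Suc k) = C k" for k by (simp_all add: c_def)
  \<comment> \<open>These are the weights \<open>C 0 * f\<^sub>N\<^sub>e (i + 1)\<close>, from which the mean of \<open>N\<close> has cancelled.\<close>
  define b where "b i = (1 - p) / p * tail (pmf Q) i" for i
  have T: "tail (pmf Q) sums m" unfolding m_def by (rule tail_pmf_sums_expectation[OF Q_int])
  have tail0: "tail (pmf Q) 0 = 1" by (rule tail_pmf_0[OF Q0])
  have "0 < m"
    using suminf_pos2[of "tail (pmf Q)" 0] T tail0 tail_pmf_nonneg by (auto simp: sums_iff)
  have b_nonneg: "0 \<le> b i" for i using p tail_pmf_nonneg by (simp add: b_def)
  have b_sums: "b sums ((1 - p) / p * m)" unfolding b_def by (rule sums_mult[OF T])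
  have b_less: "(1 - p) / p * m < 1" using net_profit mean_Y by (simp add: mult.commute)
  have renewal: "c (Suc k) = (\<Sum>i. b i * c (k - i))" for k
    using equilibrium_recursion[OF T, of f\<^sub>N\<^sub>e C "(1 - p) / p" k] \<open>0 < m\<close> f\<^sub>N\<^sub>e C_0 C_rec
    unfolding m fN c_def b_def by simp
  note bounds = defective_renewal_bounds[of b _ c, OF b_nonneg b_sums b_less c_simps(1) renewal]
  have c01: "0 \<le> c k" "c k \<le> 1" for k using bounds by auto
  have difference: "(1 - p) * measure_pmf.expectation Q (\<lambda>n. c (Suc k - n)) = c (Suc k) - p * c (Suc (Suc k))" for k
    by (rule defective_renewal_difference[OF p(1) Q0 sums_summable[OF T] c01 renewal[unfolded b_def]])

  have C_dec: "decseq C"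
    using decseqD[OF bounds(3), of "Suc _" "Suc _"] by (auto simp: decseq_def)
  have C_lim: "C \<longlonglongrightarrow> 0" and C_bounded: "\<bar>C k\<bar> \<le> 1" for k
    using LIMSEQ_Suc[OF bounds(4)] c01[of "Suc k"] by auto
  let ?E = "\<lambda>v. measure_pmf.expectation (neg_binomial_pmf v (1 - p)) C"
  have mixed: "mixed_ruin p c v = ?E v" if "1 \<le> v" for v
    using that by (simp add: mixed_ruin_def)
  have "?E \<longlonglongrightarrow> 0"
    by (rule expectation_neg_binomial_tendsto_0) (use p C_dec C_lim in auto)
  moreover have "\<forall>\<^sub>F v in sequentially. mixed_ruin p c v = ?E v"
    using eventually_ge_at_top[of 1] by eventually_elim (rule mixed)
  ultimately have mixed_lim: "mixed_ruin p c \<longlonglongrightarrow> 0"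
    by (simp add: tendsto_cong)
  have "(\<lambda>t. finite_horizon_ruin W t u) \<longlonglongrightarrow> mixed_ruin p c u"
  proof (rule finite_horizon_ruin_tendsto)
    show "0 < pmf W y" for y
      unfolding W_def by (rule pmf_neg_binomial_mixture_pos[OF p Q0])
    show "mixed_ruin p c v = measure_pmf.expectation W (\<lambda>y. mixed_ruin p c (Suc v - y))" if "1 \<le> v" for v
      unfolding W_def by (rule mixed_ruin_harmonic[OF p c01 c_simps(1) difference that])
  qed (use mixed_ruin_unit_interval[of c p] c01 mixed_lim in auto)
  moreover have "(\<lambda>t. finite_horizon_ruin W t u) \<longlonglongrightarrow> ruin_prob M Y u"
    by (rule M.finite_horizon_ruin_tendsto_ruin_prob[OF Y_indep Y_distr u])
  ultimately have ruin: "ruin_prob M Y u = ?E u"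
    using mixed[OF u] LIMSEQ_unique by metis

  note Z_transfer = distr_eq_pmf_transfer[OF distributed_measurable[OF Z] distributed_pmf_distr[OF Z]]
  have "(\<lambda>k. C k * measure R {\<omega> \<in> space R. Z \<omega> = k}) sums ruin_prob M Y u"
    using expectation_pmf_sums[of C 1 "neg_binomial_pmf u (1 - p)", OF C_bounded]
    by (simp add: ruin Z_transfer(1) mult.commute)
  moreover have "integrable R (\<lambda>\<omega>. C (Z \<omega>))"
    by (simp add: Z_transfer(2) integrable_pmf_bounded[OF C_bounded])
  ultimately show ?thesis
    using int_Y mean_Y ruin by (simp add: m Z_transfer(3))
qed

end
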